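(* Let $X$ be the shift space with alphabet $\{1,\bar 1,2,3\}$ defined by the set of forbidden blocks $\{\bar 1 2^n 3 : n\ge 0\}$, and let $Y$ be the full shift $\{1,2,3\}^{\mathbb{Z}}$. Then $X$ is an irreducible sofic shift. Let $\phi:X\to Y$ be the 1-block code defined by $\phi(1)=\phi(\bar 1)=1$, $\phi(2)=2$, $\phi(3)=3$. Then $\phi$ is a right continuing factor map (in particular onto $Y$) without a retract, i.e. no $n\in\mathbb{N}$ is a retract of $\phi$.
   Context: A shift space over a finite alphabet $A$ is a closed shift-invariant subset of $A^{\mathbb{Z}}$. A block code between shift spaces is a continuous shift-commuting map; it is a 1-block code if $(\phi(x))_0$ is determined by $x_0$, in which case $\phi$ also denotes the induced map on symbols. A factor map is an onto block code. A shift of finite type (SFT) is a shift space determined by a finite set of forbidden words, and a sofic shift is a factor of an SFT. Two points $x,x'$ are left asymptotic if there is $n\in\mathbb{Z}$ with $x_i=x'_i$ for all $i\le n$. A block code $\phi$ from $X$ onto $Y$ is right continuing if for each $x\in X$ and $y\in Y$ such that $\phi(x)$ is left asymptotic to $y$, there is at least one $\bar x\in X$ that is left asymptotic to $x$ with $\phi(\bar x)=y$. A right continuing code $\phi$ from $X$ onto $Y$ has a retract $n\in\mathbb{N}$ (where $0\in\mathbb{N}$) if for all $x\in X$ and $y\in Y$ with $(\phi x)_i=y_i$ for all $i\le 0$, there is $\bar x\in X$ with $\phi\bar x=y$ and $\bar x_i=x_i$ for all $i\le -n$. *)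

theory Defs
  imports "HOL-Analysis.Analysis"
begin

section \<open>Shift spaces over a finite alphabet\<close>

definition seq_topology :: "'a set \<Rightarrow> (int \<Rightarrow> 'a) topology" where
  "seq_topology A = product_topology (\<lambda>_. discrete_topology A) UNIV"

definition full_shift :: "'a set \<Rightarrow> (int \<Rightarrow> 'a) set" where
  "full_shift A = {x. \<forall>i. x i \<in> A}"

definition shift :: "(int \<Rightarrow> 'a) \<Rightarrow> (int \<Rightarrow> 'a)" where
  "shift x = (\<lambda>i. x (i + 1))"

text \<open>Closedness in \<^term>\<open>seq_topology A\<close> includes
  \<^prop>\<open>X \<subseteq> full_shift A\<close>.\<close>

definition shift_space :: "'a set \<Rightarrow> (int \<Rightarrow> 'a) set \<Rightarrow> bool" where
  "shift_space A X \<longleftrightarrow> finite A \<and> closedin (seq_topology A) X \<and> shift ` X = X"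

definition word_at :: "'a list \<Rightarrow> int \<Rightarrow> (int \<Rightarrow> 'a) \<Rightarrow> bool" where
  "word_at w i x \<longleftrightarrow> (\<forall>k<length w. x (i + int k) = w ! k)"

definition forbidden_shift :: "'a set \<Rightarrow> 'a list set \<Rightarrow> (int \<Rightarrow> 'a) set" where
  "forbidden_shift A F = {x \<in> full_shift A. \<forall>w\<in>F. \<forall>i. \<not> word_at w i x}"

definition language :: "(int \<Rightarrow> 'a) set \<Rightarrow> 'a list set" where
  "language X = {w. \<exists>x\<in>X. \<exists>i. word_at w i x}"

definition irreducible_shift :: "'a set \<Rightarrow> (int \<Rightarrow> 'a) set \<Rightarrow> bool" where
  "irreducible_shift A X \<longleftrightarrow> shift_space A X \<and>
     (\<forall>u\<in>language X. \<forall>v\<in>language X. \<exists>w. u @ w @ v \<in> language X)"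

definition shift_of_finite_type :: "'a set \<Rightarrow> (int \<Rightarrow> 'a) set \<Rightarrow> bool" where
  "shift_of_finite_type A X \<longleftrightarrow> finite A \<and>
     (\<exists>F. finite F \<and> F \<subseteq> lists A \<and> X = forbidden_shift A F)"

section \<open>Block codes\<close>

definition block_code ::
  "'a set \<Rightarrow> (int \<Rightarrow> 'a) set \<Rightarrow> 'b set \<Rightarrow> (int \<Rightarrow> 'b) set \<Rightarrow>
    ((int \<Rightarrow> 'a) \<Rightarrow> (int \<Rightarrow> 'b)) \<Rightarrow> bool" where
  "block_code A X B Y \<phi> \<longleftrightarrow> shift_space A X \<and> shift_space B Y \<and>
     continuous_map (subtopology (seq_topology A) X) (subtopology (seq_topology B) Y) \<phi> \<and>
     (\<forall>x\<in>X. \<phi> (shift x) = shift (\<phi> x))"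

definition one_block_code ::
  "'a set \<Rightarrow> (int \<Rightarrow> 'a) set \<Rightarrow> 'b set \<Rightarrow> (int \<Rightarrow> 'b) set \<Rightarrow>
    ((int \<Rightarrow> 'a) \<Rightarrow> (int \<Rightarrow> 'b)) \<Rightarrow> bool" where
  "one_block_code A X B Y \<phi> \<longleftrightarrow> block_code A X B Y \<phi> \<and>
     (\<exists>f. \<forall>x\<in>X. \<phi> x 0 = f (x 0))"

definition factor_map ::
  "'a set \<Rightarrow> (int \<Rightarrow> 'a) set \<Rightarrow> 'b set \<Rightarrow> (int \<Rightarrow> 'b) set \<Rightarrow>
    ((int \<Rightarrow> 'a) \<Rightarrow> (int \<Rightarrow> 'b)) \<Rightarrow> bool" where
  "factor_map A X B Y \<phi> \<longleftrightarrow> block_code A X B Y \<phi> \<and> \<phi> ` X = Y"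

text \<open>The alphabet of the covering shift of finite type may be any finite set;
  up to renaming its symbols are natural numbers.\<close>

definition sofic :: "'a set \<Rightarrow> (int \<Rightarrow> 'a) set \<Rightarrow> bool" where
  "sofic A X \<longleftrightarrow> (\<exists>(B :: nat set) Z \<pi>. shift_of_finite_type B Z \<and> factor_map B Z A X \<pi>)"

definition left_asymptotic :: "(int \<Rightarrow> 'a) \<Rightarrow> (int \<Rightarrow> 'a) \<Rightarrow> bool" where
  "left_asymptotic x x' \<longleftrightarrow> (\<exists>n. \<forall>i\<le>n. x i = x' i)"

definition right_continuing ::
  "'a set \<Rightarrow> (int \<Rightarrow> 'a) set \<Rightarrow> 'b set \<Rightarrow> (int \<Rightarrow> 'b) set \<Rightarrow>
    ((int \<Rightarrow> 'a) \<Rightarrow> (int \<Rightarrow> 'b)) \<Rightarrow> bool" where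
  "right_continuing A X B Y \<phi> \<longleftrightarrow> factor_map A X B Y \<phi> \<and>
     (\<forall>x\<in>X. \<forall>y\<in>Y. left_asymptotic (\<phi> x) y \<longrightarrow>
        (\<exists>x'\<in>X. left_asymptotic x' x \<and> \<phi> x' = y))"

definition is_retract ::
  "(int \<Rightarrow> 'a) set \<Rightarrow> (int \<Rightarrow> 'b) set \<Rightarrow> ((int \<Rightarrow> 'a) \<Rightarrow> (int \<Rightarrow> 'b)) \<Rightarrow> nat \<Rightarrow> bool" where
  "is_retract X Y \<phi> n \<longleftrightarrow>
     (\<forall>x\<in>X. \<forall>y\<in>Y. (\<forall>i\<le>0. \<phi> x i = y i) \<longrightarrow>
        (\<exists>x'\<in>X. \<phi> x' = y \<and> (\<forall>i \<le> - int n. x' i = x i)))"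

section \<open>The example\<close>

datatype symbol = One | OneBar | Two | Three

definition alphX :: "symbol set" where
  "alphX = {One, OneBar, Two, Three}"

definition alphY :: "symbol set" where
  "alphY = {One, Two, Three}"

definition shiftX :: "(int \<Rightarrow> symbol) set" where
  "shiftX = forbidden_shift alphX {[OneBar] @ replicate n Two @ [Three] | n. True}"

definition shiftY :: "(int \<Rightarrow> symbol) set" where
  "shiftY = full_shift alphY"

fun phi_symbol :: "symbol \<Rightarrow> symbol" where
  "phi_symbol One = One"
| "phi_symbol OneBar = One"
| "phi_symbol Two = Two"
| "phi_symbol Three = Three"

definition phi :: "(int \<Rightarrow> symbol) \<Rightarrow> (int \<Rightarrow> symbol)" where
  "phi x = (\<lambda>i. phi_symbol (x i))"

end

theory Submission
  imports Defs
begin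

text \<open>
  A point lies in \<^term>\<open>shiftX\<close> iff no \<^term>\<open>OneBar\<close> is joined to a later \<^term>\<open>Three\<close> by a
  (possibly empty) run of \<^term>\<open>Two\<close>s. Two points can therefore be glued at any position that holds
  a \<^term>\<open>One\<close>, since a \<^term>\<open>One\<close> cuts every such run; this gives irreducibility. Likewise
  \<^term>\<open>shiftY\<close>, whose points contain no \<^term>\<open>OneBar\<close>, is a subset of \<^term>\<open>shiftX\<close> that
  \<^term>\<open>phi\<close> fixes pointwise, which gives surjectivity.

  For soficity, split the symbol \<^term>\<open>Two\<close> into a neutral copy and a copy that
  remembers a \<^term>\<open>OneBar\<close> at the start of the run. Over the larger alphabet the constraint concerns
  adjacent symbols only: after a \<^term>\<open>OneBar\<close> or a remembering \<^term>\<open>Two\<close> there may be neither a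
  neutral \<^term>\<open>Two\<close> nor a \<^term>\<open>Three\<close>.

  For right continuation, suppose that \<^term>\<open>phi x\<close> and \<^term>\<open>y\<close> agree far to the left. If
  \<^term>\<open>x\<close> has a symbol other than \<^term>\<open>Two\<close> in that region, keep \<^term>\<open>x\<close> strictly before it and
  continue with \<^term>\<open>y\<close> from there on, which turns a \<^term>\<open>OneBar\<close> at the gluing position into
  a \<^term>\<open>One\<close>. Otherwise \<^term>\<open>y\<close> itself is left asymptotic to \<^term>\<open>x\<close>. The position of that
  symbol is unbounded, and this is why there is no retract: if the past of \<^term>\<open>x\<close> ends
  in \<^term>\<open>OneBar\<close> followed by \<^term>\<open>n\<close> \<^term>\<open>Two\<close>s and the next symbol of \<^term>\<open>y\<close>
  is \<^term>\<open>Three\<close>, the \<^term>\<open>OneBar\<close> at position \<^term>\<open>- int n\<close> has to be changed.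
\<close>

section \<open>Forbidden words and symbolwise maps\<close>

lemma topspace_seq_topology: "topspace (seq_topology A) = full_shift A"
  by (auto simp: seq_topology_def full_shift_def)

lemma continuous_map_coordinate:
  "continuous_map (seq_topology A) (discrete_topology A) (\<lambda>x. x i)"
  unfolding seq_topology_def by (rule continuous_map_product_projection) simp

lemma openin_word_at:
  "openin (seq_topology A) {x \<in> full_shift A. word_at w i x}"
proof -
  have coord: "openin (seq_topology A) {x \<in> full_shift A. x j = a}" for j a
  proof -
    have "openin (seq_topology A) {x \<in> topspace (seq_topology A). x j \<in> {a} \<inter> A}"
      by (rule openin_continuous_map_preimage[OF continuous_map_coordinate]) simp
    moreover have "{x \<in> topspace (seq_topology A). x j \<in> {a} \<inter> A} = {x \<in> full_shift A. x j = a}"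
      by (auto simp: topspace_seq_topology full_shift_def)
    ultimately show ?thesis by simp
  qed
  have "openin (seq_topology A) ((\<Inter>k\<in>{..<length w}. {x \<in> full_shift A. x (i + int k) = w ! k})
      \<inter> topspace (seq_topology A))"
    by (intro openin_INT) (auto simp: coord)
  moreover have "(\<Inter>k\<in>{..<length w}. {x \<in> full_shift A. x (i + int k) = w ! k})
      \<inter> topspace (seq_topology A) = {x \<in> full_shift A. word_at w i x}"
    by (auto simp: word_at_def topspace_seq_topology)
  ultimately show ?thesis by simp
qed

lemma word_at_translate: "word_at w i (\<lambda>k. x (k + c)) \<longleftrightarrow> word_at w (i + c) x"
  by (simp add: word_at_def algebra_simps)

lemma forbidden_shift_translate:
  assumes "x \<in> forbidden_shift A F"
  shows "(\<lambda>k. x (k + c)) \<in> forbidden_shift A F"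
  using assms by (auto simp: forbidden_shift_def full_shift_def word_at_translate)

lemma shift_space_forbidden_shift:
  assumes "finite A"
  shows "shift_space A (forbidden_shift A F)"
proof -
  have "full_shift A - forbidden_shift A F =
      (\<Union>w\<in>F. \<Union>i. {x \<in> full_shift A. word_at w i x})"
    by (auto simp: forbidden_shift_def)
  then have "openin (seq_topology A) (full_shift A - forbidden_shift A F)"
    by (auto intro!: openin_Union simp: openin_word_at)
  moreover have "forbidden_shift A F \<subseteq> full_shift A"
    by (auto simp: forbidden_shift_def)
  ultimately have "closedin (seq_topology A) (forbidden_shift A F)"
    by (simp add: closedin_def topspace_seq_topology)
  moreover have "shift ` forbidden_shift A F = forbidden_shift A F"
  proof
    show "shift ` forbidden_shift A F \<subseteq> forbidden_shift A F"
      by (auto simp: shift_def intro: forbidden_shift_translate)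
    show "forbidden_shift A F \<subseteq> shift ` forbidden_shift A F"
    proof
      fix x assume "x \<in> forbidden_shift A F"
      then have "(\<lambda>k. x (k + - 1)) \<in> forbidden_shift A F"
        by (rule forbidden_shift_translate)
      then have "shift (\<lambda>k. x (k + - 1)) \<in> shift ` forbidden_shift A F"
        by (rule imageI)
      then show "x \<in> shift ` forbidden_shift A F"
        by (simp add: shift_def)
    qed
  qed
  ultimately show ?thesis using assms by (simp add: shift_space_def)
qed

lemma block_code_symbolwise:
  assumes X: "shift_space A X" and Y: "shift_space B Y"
    and f: "f ` A \<subseteq> B" and XY: "(\<lambda>x i. f (x i)) ` X \<subseteq> Y"
  shows "block_code A X B Y (\<lambda>x i. f (x i))"
proof -
  have "continuous_map (seq_topology A) (discrete_topology B) (f \<circ> (\<lambda>x. x i))" for i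
    by (rule continuous_map_compose[OF continuous_map_coordinate]) (use f in auto)
  then have "continuous_map (seq_topology A) (seq_topology B) (\<lambda>x i. f (x i))"
    by (subst (2) seq_topology_def) (simp add: continuous_map_componentwise_UNIV o_def)
  then have "continuous_map (subtopology (seq_topology A) X) (seq_topology B) (\<lambda>x i. f (x i))"
    by (rule continuous_map_from_subtopology)
  then have "continuous_map (subtopology (seq_topology A) X) (subtopology (seq_topology B) Y)
      (\<lambda>x i. f (x i))"
    using XY by (auto simp: continuous_map_in_subtopology)
  then show ?thesis
    using X Y by (simp add: block_code_def shift_def)
qed

section \<open>The two shift spaces\<close>

lemma alphX_UNIV: "alphX = UNIV"
  unfolding alphX_def by (auto intro: symbol.exhaust)

lemma word_at_forbidden:
  "word_at ([OneBar] @ replicate n Two @ [Three]) i x \<longleftrightarrow>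
     x i = OneBar \<and> (\<forall>k. i < k \<and> k < i + int n + 1 \<longrightarrow> x k = Two) \<and> x (i + int n + 1) = Three"
    (is "word_at ?w i x \<longleftrightarrow> ?R")
proof
  assume "word_at ?w i x"
  then have L: "x (i + int k) = ?w ! k" if "k < n + 2" for k
    using that by (simp add: word_at_def)
  have "x k = Two" if k: "i < k" "k < i + int n + 1" for k
  proof -
    obtain l where l: "k = i + int (Suc l)"
      using k(1) by (metis zless_iff_Suc_zadd)
    then show ?thesis using L[of "Suc l"] k(2) by (simp add: nth_append)
  qed
  moreover have "x i = OneBar" using L[of 0] by simp
  moreover have "x (i + int n + 1) = Three"
    using L[of "n + 1"] by (simp add: nth_append algebra_simps)
  ultimately show ?R by simp
next
  assume R: ?R
  show "word_at ?w i x"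
    unfolding word_at_def
  proof (intro allI impI)
    fix k assume k: "k < length ?w"
    show "x (i + int k) = ?w ! k"
    proof (cases k)
      case 0
      then show ?thesis using R by simp
    next
      case (Suc l)
      then consider "l < n" | "l = n" using k by fastforce
      then show ?thesis
      proof cases
        case 1
        then show ?thesis using R Suc by (simp add: nth_append)
      next
        case 2
        then show ?thesis using R Suc by (simp add: nth_append algebra_simps)
      qed
    qed
  qed
qed

text \<open>A forbidden block is determined by the positions of its two ends. Quantifying over these
  instead of over words and their lengths makes the condition easy to check for glued points.\<close>

lemma shiftX_iff:
  "x \<in> shiftX \<longleftrightarrow>
     (\<forall>i j. i < j \<and> x i = OneBar \<and> x j = Three \<longrightarrow> (\<exists>k. i < k \<and> k < j \<and> x k \<noteq> Two))"
    (is "_ \<longleftrightarrow> ?R")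
proof
  assume x: "x \<in> shiftX"
  show ?R
  proof (intro allI impI, rule ccontr)
    fix i j
    assume ij: "i < j \<and> x i = OneBar \<and> x j = Three"
      and twos: "\<not> (\<exists>k. i < k \<and> k < j \<and> x k \<noteq> Two)"
    have "word_at ([OneBar] @ replicate (nat (j - i - 1)) Two @ [Three]) i x"
      unfolding word_at_forbidden using ij twos by auto
    with x show False
      unfolding shiftX_def forbidden_shift_def by blast
  qed
next
  assume R: ?R
  have "\<not> word_at ([OneBar] @ replicate n Two @ [Three]) i x" for n i
  proof
    assume "word_at ([OneBar] @ replicate n Two @ [Three]) i x"
    then show False
      unfolding word_at_forbidden using R[rule_format, of i "i + int n + 1"] by auto
  qed
  then show "x \<in> shiftX"
    unfolding shiftX_def forbidden_shift_def full_shift_def alphX_UNIV by auto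
qed

lemma shiftX_translate: "x \<in> shiftX \<Longrightarrow> (\<lambda>k. x (k + c)) \<in> shiftX"
  unfolding shiftX_def by (rule forbidden_shift_translate)

lemma shiftX_update_One:
  assumes "x \<in> shiftX"
  shows "x(m := One) \<in> shiftX"
  unfolding shiftX_iff
proof (intro allI impI)
  fix i j
  assume "i < j \<and> (x(m := One)) i = OneBar \<and> (x(m := One)) j = Three"
  then have "i < j \<and> x i = OneBar \<and> x j = Three" by (auto split: if_splits)
  then obtain k where "i < k" "k < j" "x k \<noteq> Two"
    using assms unfolding shiftX_iff by blast
  then show "\<exists>k. i < k \<and> k < j \<and> (x(m := One)) k \<noteq> Two"
    by (intro exI[of _ k]) simp
qed

text \<open>The symbol at the gluing position cuts every run of \<^term>\<open>Two\<close>s, so a forbidden block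
  that meets both halves of the glued point would have to end exactly at that position. It would then
  already occur in the left point, which also has a \<^term>\<open>Three\<close> there.\<close>

lemma shiftX_glue:
  assumes x: "x \<in> shiftX" and y: "y \<in> shiftX"
    and cut: "y m \<noteq> Two" and Three: "y m = Three \<Longrightarrow> x m = Three"
  shows "(\<lambda>k. if k < m then x k else y k) \<in> shiftX" (is "?z \<in> _")
  unfolding shiftX_iff
proof (intro allI impI)
  fix i j
  assume ij: "i < j \<and> ?z i = OneBar \<and> ?z j = Three"
  consider "j \<le> m" | "i < m" "m < j" | "m \<le> i" by linarith
  then show "\<exists>k. i < k \<and> k < j \<and> ?z k \<noteq> Two"
  proof cases
    case 1
    then have "i < j \<and> x i = OneBar \<and> x j = Three"
      using ij Three by (auto split: if_splits)
    then obtain k where "i < k" "k < j" "x k \<noteq> Two"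
      using x unfolding shiftX_iff by blast
    with 1 show ?thesis by (intro exI[of _ k]) simp
  next
    case 2
    with cut show ?thesis by (intro exI[of _ m]) simp
  next
    case 3
    then have "i < j \<and> y i = OneBar \<and> y j = Three" using ij by auto
    then obtain k where "i < k" "k < j" "y k \<noteq> Two"
      using y unfolding shiftX_iff by blast
    with 3 show ?thesis by (intro exI[of _ k]) simp
  qed
qed

lemma shift_space_shiftX: "shift_space alphX shiftX"
  unfolding shiftX_def by (rule shift_space_forbidden_shift) (simp add: alphX_def)

lemma shift_space_shiftY: "shift_space alphY shiftY"
proof -
  have "shiftY = forbidden_shift alphY {}"
    by (simp add: shiftY_def forbidden_shift_def)
  moreover have "shift_space alphY (forbidden_shift alphY {})"
    by (rule shift_space_forbidden_shift) (simp add: alphY_def)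
  ultimately show ?thesis by simp
qed

lemma irreducible_shiftX: "irreducible_shift alphX shiftX"
  unfolding irreducible_shift_def
proof (intro conjI ballI shift_space_shiftX)
  fix u v
  assume "u \<in> language shiftX" "v \<in> language shiftX"
  then obtain x i y j where x: "x \<in> shiftX" "word_at u i x" and y: "y \<in> shiftX" "word_at v j y"
    by (auto simp: language_def)
  define m where "m = i + int (length u)"
  \<comment> \<open>\<^term>\<open>v\<close> is moved to start at \<^term>\<open>m + 1\<close>, right after the cutting symbol.\<close>
  define y' where "y' = (\<lambda>k. y (k + (j - (m + 1))))(m := One)"
  define z where "z = (\<lambda>k. if k < m then x k else y' k)"
  have y': "y' \<in> shiftX"
    unfolding y'_def by (intro shiftX_update_One shiftX_translate y)
  have m: "y' m = One" by (simp add: y'_def)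
  have "z \<in> shiftX"
    unfolding z_def using m by (intro shiftX_glue x y') auto
  moreover have "word_at (u @ [One] @ v) i z"
    unfolding word_at_def
  proof (intro allI impI)
    fix k assume k: "k < length (u @ [One] @ v)"
    consider "k < length u" | "k = length u" | l where "k = length u + 1 + l" "l < length v"
    proof (cases "k \<le> length u")
      case True
      then show ?thesis using that(1,2) by linarith
    next
      case False
      show ?thesis
        by (rule that(3)[of "k - length u - 1"]) (use False k in auto)
    qed
    then show "z (i + int k) = (u @ [One] @ v) ! k"
    proof cases
      case 1
      then show ?thesis using x by (simp add: z_def m_def word_at_def nth_append)
    next
      case 2
      then show ?thesis using m by (simp add: z_def m_def nth_append)
    next
      case 3
      have "z (i + int k) = y (j + int l)"
        using 3 by (simp add: z_def y'_def m_def algebra_simps)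
      also have "\<dots> = v ! l" using y 3 by (simp add: word_at_def)
      finally show ?thesis using 3 by (simp add: nth_append)
    qed
  qed
  ultimately have "u @ [One] @ v \<in> language shiftX"
    unfolding language_def by blast
  then show "\<exists>w. u @ w @ v \<in> language shiftX" by blast
qed

section \<open>A finite type cover\<close>

text \<open>The numbers 0, 1, 3 stand for \<^term>\<open>One\<close>, \<^term>\<open>OneBar\<close>, \<^term>\<open>Three\<close>; 2 and 4 are the
  neutral copy of \<^term>\<open>Two\<close> and the copy that remembers a \<^term>\<open>OneBar\<close>.\<close>

definition cover_symbol :: "nat \<Rightarrow> symbol" where
  "cover_symbol a = (if a = 0 then One else if a = 1 then OneBar else if a = 3 then Three else Two)"

definition cover :: "(int \<Rightarrow> nat) set" where
  "cover = forbidden_shift {0,1,2,3,4} {[1,2],[1,3],[4,2],[4,3]}"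

lemma cover_iff:
  "z \<in> cover \<longleftrightarrow> (\<forall>i. z i \<in> {0,1,2,3,4}) \<and> (\<forall>i. z i \<in> {1,4} \<longrightarrow> z (i + 1) \<notin> {2,3})"
proof -
  have "word_at [a, b] i z \<longleftrightarrow> z i = a \<and> z (i + 1) = b" for a b i
    by (auto simp: word_at_def less_Suc_eq numeral_2_eq_2)
  then show ?thesis
    unfolding cover_def forbidden_shift_def full_shift_def by auto
qed

lemma cover_into_shiftX:
  assumes z: "z \<in> cover"
  shows "(\<lambda>i. cover_symbol (z i)) \<in> shiftX"
  unfolding shiftX_iff
proof (intro allI impI, rule ccontr)
  fix i j
  assume ij: "i < j \<and> cover_symbol (z i) = OneBar \<and> cover_symbol (z j) = Three"
    and twos: "\<not> (\<exists>k. i < k \<and> k < j \<and> cover_symbol (z k) \<noteq> Two)"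
  have "k < j \<longrightarrow> z k \<in> {1,4}" if "i \<le> k" for k
    using that
  proof (induction k rule: int_ge_induct)
    case base
    then show ?case using ij by (auto simp: cover_symbol_def split: if_splits)
  next
    case (step k)
    show ?case
    proof
      assume less: "k + 1 < j"
      then have "z (k + 1) \<notin> {2,3}"
        using step z unfolding cover_iff by auto
      moreover have "cover_symbol (z (k + 1)) = Two"
        using less step twos by auto
      moreover have "z (k + 1) \<in> {0,1,2,3,4}"
        using z unfolding cover_iff by blast
      ultimately show "z (k + 1) \<in> {1,4}"
        by (auto simp: cover_symbol_def split: if_splits)
    qed
  qed
  from this[of "j - 1"] have "z (j - 1) \<in> {1,4}" using ij by auto
  then have "z (j - 1 + 1) \<notin> {2,3}"
    using z unfolding cover_iff by blast
  then show False using ij by (auto simp: cover_symbol_def split: if_splits)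
qed

text \<open>Marking the \<^term>\<open>Two\<close>s by what precedes them makes the mark propagate to the right along a
  run, as the cover demands; a marked position directly before a \<^term>\<open>Three\<close> would exhibit a
  forbidden block.\<close>

lemma cover_image_of_shiftX:
  assumes x: "x \<in> shiftX"
  shows "x \<in> (\<lambda>z i. cover_symbol (z i)) ` cover"
proof -
  define marked where
    "marked i \<longleftrightarrow> (\<exists>k\<le>i. x k = OneBar \<and> (\<forall>l. k < l \<and> l \<le> i \<longrightarrow> x l = Two))" for i
  define z :: "int \<Rightarrow> nat" where
    "z i = (case x i of One \<Rightarrow> 0 | OneBar \<Rightarrow> 1 | Two \<Rightarrow> if marked i then 4 else 2 | Three \<Rightarrow> 3)" for i
  have "x = (\<lambda>i. cover_symbol (z i))"
    by (rule ext) (simp add: z_def cover_symbol_def split: symbol.split)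
  moreover have "z (i + 1) \<notin> {2,3}" if "z i \<in> {1,4}" for i
  proof -
    have "marked i"
      using that by (auto simp: z_def marked_def split: symbol.splits if_splits)
    then obtain k where k: "k \<le> i" "x k = OneBar" "\<forall>l. k < l \<and> l \<le> i \<longrightarrow> x l = Two"
      by (auto simp: marked_def)
    have "x (i + 1) \<noteq> Three"
    proof
      assume "x (i + 1) = Three"
      then obtain l where "k < l" "l < i + 1" "x l \<noteq> Two"
        using x[unfolded shiftX_iff, rule_format, of k "i + 1"] k(1,2) by auto
      with k(3) show False by auto
    qed
    moreover have "marked (i + 1)" if "x (i + 1) = Two"
    proof -
      have "x l = Two" if "k < l" "l \<le> i + 1" for l
        using that k(3) \<open>x (i + 1) = Two\<close> by (cases "l = i + 1") auto
      then show ?thesis unfolding marked_def using k by (intro exI[of _ k]) auto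
    qed
    ultimately show ?thesis
      by (auto simp: z_def split: symbol.splits if_splits)
  qed
  moreover have "z i \<in> {0,1,2,3,4}" for i
    by (simp add: z_def split: symbol.split)
  ultimately show ?thesis
    by (intro image_eqI[where x = z]) (simp_all add: cover_iff del: insert_iff)
qed

lemma sofic_shiftX: "sofic alphX shiftX"
proof -
  have sft: "shift_of_finite_type {0,1,2,3,4} cover"
    unfolding shift_of_finite_type_def cover_def
    by (intro conjI exI[of _ "{[1,2],[1,3],[4,2],[4,3]}"]) auto
  have "block_code {0,1,2,3,4} cover alphX shiftX (\<lambda>z i. cover_symbol (z i))"
  proof (rule block_code_symbolwise)
    show "shift_space {0,1,2,3,4} cover"
      unfolding cover_def by (rule shift_space_forbidden_shift) simp
    show "shift_space alphX shiftX" by (rule shift_space_shiftX)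
  qed (simp_all add: alphX_UNIV cover_into_shiftX image_subset_iff)
  moreover have "(\<lambda>z i. cover_symbol (z i)) ` cover = shiftX"
  proof
    show "(\<lambda>z i. cover_symbol (z i)) ` cover \<subseteq> shiftX"
      by (rule image_subsetI) (rule cover_into_shiftX)
    show "shiftX \<subseteq> (\<lambda>z i. cover_symbol (z i)) ` cover"
      by (rule subsetI) (rule cover_image_of_shiftX)
  qed
  ultimately have "factor_map {0,1,2,3,4} cover alphX shiftX (\<lambda>z i. cover_symbol (z i))"
    by (simp add: factor_map_def)
  with sft show ?thesis
    unfolding sofic_def by (intro exI conjI)
qed

section \<open>The code\<close>

lemma shiftY_ne_OneBar: "y \<in> shiftY \<Longrightarrow> y i \<noteq> OneBar"
  by (metis (no_types, lifting) alphY_def full_shift_def insertE mem_Collect_eq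
      shiftY_def singletonD symbol.distinct)

lemma shiftY_subset_shiftX: "shiftY \<subseteq> shiftX"
  by (auto simp: shiftX_iff shiftY_ne_OneBar)

lemma phi_symbol_eq_self: "a \<noteq> OneBar \<Longrightarrow> phi_symbol a = a"
  by (cases a) auto

lemma phi_symbol_eq_iff [simp]:
  "phi_symbol a = Two \<longleftrightarrow> a = Two" "phi_symbol a = Three \<longleftrightarrow> a = Three"
  by (cases a; simp)+

lemma phi_shiftY: "y \<in> shiftY \<Longrightarrow> phi y = y"
  by (simp add: phi_def phi_symbol_eq_self shiftY_ne_OneBar)

lemma phi_in_shiftY: "phi x \<in> shiftY"
proof -
  have "phi_symbol a \<in> alphY" for a by (cases a) (auto simp: alphY_def)
  then show ?thesis by (simp add: phi_def shiftY_def full_shift_def)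
qed

lemma block_code_phi: "block_code alphX shiftX alphY shiftY phi"
  unfolding phi_def[abs_def]
proof (rule block_code_symbolwise[OF shift_space_shiftX shift_space_shiftY])
  show "phi_symbol ` alphX \<subseteq> alphY" by (auto simp: alphX_def alphY_def)
  show "(\<lambda>x i. phi_symbol (x i)) ` shiftX \<subseteq> shiftY"
    using phi_in_shiftY by (auto simp: phi_def)
qed

lemma one_block_code_phi: "one_block_code alphX shiftX alphY shiftY phi"
  unfolding one_block_code_def by (auto simp: block_code_phi phi_def)

lemma factor_map_phi: "factor_map alphX shiftX alphY shiftY phi"
proof -
  have "y \<in> phi ` shiftX" if "y \<in> shiftY" for y
    using that shiftY_subset_shiftX phi_shiftY by (intro image_eqI[of _ _ y]) auto
  then show ?thesis by (auto simp: factor_map_def block_code_phi phi_in_shiftY)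
qed

lemma right_continuing_phi: "right_continuing alphX shiftX alphY shiftY phi"
  unfolding right_continuing_def
proof (intro conjI ballI impI factor_map_phi)
  fix x y
  assume x: "x \<in> shiftX" and y: "y \<in> shiftY" and "left_asymptotic (phi x) y"
  then obtain n where n: "\<And>i. i \<le> n \<Longrightarrow> phi_symbol (x i) = y i"
    by (auto simp: left_asymptotic_def phi_def)
  show "\<exists>x'\<in>shiftX. left_asymptotic x' x \<and> phi x' = y"
  proof (cases "\<exists>m\<le>n. x m \<noteq> Two")
    case True
    then obtain m where m: "m \<le> n" "x m \<noteq> Two" by blast
    let ?z = "\<lambda>k. if k < m then x k else y k"
    have "y m \<noteq> Two" and "y m = Three \<Longrightarrow> x m = Three"
      using n[OF m(1)] m(2) phi_symbol_eq_iff by metis+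
    then have "?z \<in> shiftX"
      using x y shiftY_subset_shiftX by (intro shiftX_glue) auto
    moreover have "left_asymptotic ?z x"
      unfolding left_asymptotic_def by (intro exI[of _ "m - 1"]) simp
    moreover have "phi ?z = y"
      using n m(1) by (auto simp: phi_def phi_symbol_eq_self shiftY_ne_OneBar[OF y])
    ultimately show ?thesis by blast
  next
    case False
    then have "y i = x i" if "i \<le> n" for i
      using n[OF that] that by auto
    then have "left_asymptotic y x" by (auto simp: left_asymptotic_def)
    then show ?thesis using y shiftY_subset_shiftX phi_shiftY by blast
  qed
qed

lemma not_is_retract_phi: "\<not> is_retract shiftX shiftY phi n"
proof
  assume retract: "is_retract shiftX shiftY phi n"
  define x where "x = (\<lambda>_ :: int. Two)(- int n := OneBar)"
  define y where "y = (phi x)(1 := Three)"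
  have "x \<in> shiftX" by (simp add: shiftX_iff x_def)
  moreover have "y \<in> shiftY"
    using phi_in_shiftY[of x] by (simp add: y_def shiftY_def full_shift_def alphY_def)
  moreover have "\<forall>i\<le>0. phi x i = y i" by (simp add: y_def)
  ultimately obtain x' where x': "x' \<in> shiftX" "phi x' = y" "\<forall>i\<le>- int n. x' i = x i"
    using retract unfolding is_retract_def by blast
  have image: "phi_symbol (x' i) = y i" for i
    using x'(2) by (auto simp: phi_def)
  have "x' (- int n) = OneBar" using x'(3) by (simp add: x_def)
  moreover have "x' 1 = Three" using image[of 1] by (simp add: y_def)
  moreover have "x' k = Two" if "- int n < k" "k < 1" for k
    using image[of k] that by (simp add: y_def x_def phi_def)
  ultimately show False
    using x'(1)[unfolded shiftX_iff, rule_format, of "- int n" 1] by auto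
qed

theorem mainTheorem2:
  shows "irreducible_shift alphX shiftX \<and> sofic alphX shiftX \<and>
    one_block_code alphX shiftX alphY shiftY phi \<and>
    factor_map alphX shiftX alphY shiftY phi \<and>
    right_continuing alphX shiftX alphY shiftY phi \<and>
    (\<forall>n. \<not> is_retract shiftX shiftY phi n)"
  by (simp add: irreducible_shiftX sofic_shiftX one_block_code_phi factor_map_phi
      right_continuing_phi not_is_retract_phi)

end
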